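(* Let $G$ be a reduced torsion-free abelian group of finite rank. Then $G$ is a $TI$-group if and only if $G$ is a homogeneous Murley group or $G$ is a $nil_a$-group.
   Context: All groups are abelian. A multiplication on a group $G$ is a homomorphism $\mu\colon G\otimes G\to G$; writing $g_1\times g_2=\mu(g_1\otimes g_2)$, it determines a (not necessarily associative) ring $(G,\times)$ with additive group $G$, called a ring on $G$. A subring $A$ of an associative ring $R$ is a meta-ideal of finite index if there is a finite chain $A=A_0\subset A_1\subset\cdots\subset A_n=R$ with $A_i$ an ideal of $A_{i+1}$ for all $i=0,\ldots,n-1$. An associative ring is filial if every meta-ideal of finite index is an ideal (equivalently, the relation "is an ideal of" is transitive). A group $G$ is a $TI$-group if every associative ring on $G$ is filial. A group $G$ is a $nil_a$-group if the only associative multiplication on $G$ is the zero multiplication. The $p$-rank $r_p(G)$ is the dimension of $G/pG$ over the field with $p$ elements. A Murley group is a reduced torsion-free group $G$ of finite rank such that $r_p(G)\le 1$ for every prime $p$. A torsion-free group is homogeneous if all its non-zero elements have the same type. *)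

theory Defs
  imports
    "HOL-Library.Extended_Nat"
    "HOL-Library.Set_Algebras"
    "HOL-Number_Theory.Residues"
    "Jordan_Normal_Form.Missing_VectorSpace"
begin

text \<open>
  The group \<open>G\<close> is the whole of a type of class \<^class>\<open>ab_group_add\<close>; group-level notions take
  the type as an argument of type \<open>'a itself\<close>.
\<close>

subsection \<open>Abelian groups as modules over the integers\<close>

definition zmult :: "int \<Rightarrow> 'a::ab_group_add \<Rightarrow> 'a" where
  "zmult n x = (if 0 \<le> n then ((+) x ^^ nat n) 0 else - (((+) x ^^ nat (- n)) 0))"

lemma zmult_0 [simp]: "zmult 0 x = 0"
  by (simp add: zmult_def)

lemma zmult_succ: "zmult (n + 1) x = zmult n x + x"
proof (cases "0 \<le> n")
  case True
  then have "nat (n + 1) = Suc (nat n)" by simp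
  with True show ?thesis by (simp add: zmult_def add.commute)
next
  case False
  then obtain k where k: "n = - int (Suc k)"
    by (metis not_le negD)
  then have "n + 1 = - int k" by simp
  then show ?thesis
    by (cases "k = 0") (simp_all add: k zmult_def nat_add_distrib algebra_simps)
qed

lemma zmult_pred: "zmult (n - 1) x = zmult n x - x"
  using zmult_succ[of "n - 1" x] by simp

lemma zmult_1 [simp]: "zmult 1 x = x"
  using zmult_succ[of 0 x] by simp

lemma zmult_add_left: "zmult (m + n) x = zmult m x + zmult n x"
proof (induction n rule: int_induct[where k = 0])
  case base show ?case by simp
next
  case (step1 i)
  then show ?case using zmult_succ[of "m + i" x] zmult_succ[of i x] by (simp add: add.assoc)
next
  case (step2 i)
  then show ?case using zmult_pred[of "m + i" x] zmult_pred[of i x] by (simp add: add_diff_eq)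
qed

lemma zmult_add_right: "zmult n (x + y) = zmult n x + zmult n y"
proof (induction n rule: int_induct[where k = 0])
  case base show ?case by simp
next
  case (step1 i)
  then show ?case unfolding zmult_succ by (simp add: add_ac)
next
  case (step2 i)
  then show ?case by (simp add: zmult_pred)
qed

lemma zmult_minus_left: "zmult (- n) x = - zmult n x"
  using zmult_add_left[of "- n" n x] by (simp add: eq_neg_iff_add_eq_0)

lemma zmult_zmult: "zmult m (zmult n x) = zmult (m * n) x"
proof (induction m rule: int_induct[where k = 0])
  case base show ?case by simp
next
  case (step1 i)
  then show ?case unfolding zmult_succ distrib_right zmult_add_left by simp
next
  case (step2 i)
  then show ?case
    unfolding zmult_pred using zmult_add_left[of "(i - 1) * n" n x] by (simp add: left_diff_distrib)
qed

global_interpretation zmod: Modules.module "zmult :: int \<Rightarrow> 'a::ab_group_add \<Rightarrow> 'a"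
  by unfold_locales (simp_all add: zmult_add_left zmult_add_right zmult_zmult)

definition additive_subgroup_on :: "'a::ab_group_add set \<Rightarrow> bool" where
  "additive_subgroup_on H \<longleftrightarrow> 0 \<in> H \<and> (\<forall>x\<in>H. \<forall>y\<in>H. x + y \<in> H) \<and> (\<forall>x\<in>H. - x \<in> H)"

definition torsion_free :: "'a::ab_group_add itself \<Rightarrow> bool" where
  "torsion_free _ \<longleftrightarrow> (\<forall>n (x::'a). zmult n x = 0 \<longrightarrow> n = 0 \<or> x = 0)"

definition divisible_on :: "'a::ab_group_add set \<Rightarrow> bool" where
  "divisible_on D \<longleftrightarrow> (\<forall>n. n \<noteq> 0 \<longrightarrow> (\<forall>x\<in>D. \<exists>y\<in>D. x = zmult n y))"

definition reduced_group :: "'a::ab_group_add itself \<Rightarrow> bool" where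
  "reduced_group _ \<longleftrightarrow>
     (\<forall>D::'a set. additive_subgroup_on D \<and> divisible_on D \<longrightarrow> D = {0})"

text \<open>
  For torsion-free groups the rank is the largest size of a set that is linearly independent over
  the integers.
\<close>

definition finite_rank :: "'a::ab_group_add itself \<Rightarrow> bool" where
  "finite_rank _ \<longleftrightarrow>
     (\<exists>n. \<forall>B::'a set. zmod.independent B \<longrightarrow> finite B \<and> card B \<le> n)"

subsection \<open>The p-rank\<close>

text \<open>
  The quotient of \<open>G\<close> by \<open>pG\<close>, whose elements are cosets. Addition is elementwise addition of
  cosets; the product of \<open>k\<close> with \<open>g + pG\<close> is \<open>kg + pG\<close>, where summing with \<open>pG\<close> matters because
  the elementwise multiple of a coset need not be a whole coset. The ring multiplication and unit
  of the record are irrelevant to the module structure.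
\<close>

definition p_multiples :: "nat \<Rightarrow> 'a::ab_group_add set" where
  "p_multiples p = range (zmult (int p))"

definition quotient_space :: "nat \<Rightarrow> (int, 'a::ab_group_add set) module" where
  "quotient_space p =
     \<lparr>carrier = range (\<lambda>g. g +o p_multiples p),
      monoid.mult = (\<lambda>_ _. undefined),
      one = undefined,
      zero = p_multiples p,
      add = (+),
      smult = (\<lambda>k C. zmult k ` C + p_multiples p)\<rparr>"

lemma p_multiples_0: "0 \<in> p_multiples p"
  unfolding p_multiples_def by (rule range_eqI[of _ _ 0]) simp

lemma p_multiples_add: "x \<in> p_multiples p \<Longrightarrow> y \<in> p_multiples p \<Longrightarrow> x + y \<in> p_multiples p"
  unfolding p_multiples_def by (elim rangeE) (metis rangeI zmult_add_right)

lemma p_multiples_minus: "x \<in> p_multiples p \<Longrightarrow> - x \<in> p_multiples p"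
  unfolding p_multiples_def by (elim rangeE) (metis rangeI zmod.scale_minus_right)

lemma zmult_p_multiples: "x \<in> p_multiples p \<Longrightarrow> zmult k x \<in> p_multiples p"
  unfolding p_multiples_def
proof (elim rangeE)
  fix y assume "x = zmult (int p) y"
  then have "zmult k x = zmult (int p) (zmult k y)" by (simp add: zmult_zmult mult.commute)
  then show "zmult k x \<in> range (zmult (int p))" by blast
qed

lemma coset_add:
  "(x +o p_multiples p) + (y +o p_multiples p) = (x + y) +o p_multiples p"
proof -
  have "p_multiples p + p_multiples p = (p_multiples p :: 'a set)"
  proof (intro equalityI subsetI)
    fix z :: 'a assume "z \<in> p_multiples p + p_multiples p"
    then show "z \<in> p_multiples p"
      unfolding set_plus_def using p_multiples_add by blast
  next
    fix z :: 'a assume "z \<in> p_multiples p"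
    then show "z \<in> p_multiples p + p_multiples p"
      using set_plus_intro[OF _ p_multiples_0[of p]] by force
  qed
  then show ?thesis by (simp only: set_plus_rearrange)
qed

lemma coset_smult:
  "zmult k ` (x +o p_multiples p) + p_multiples p = zmult k x +o p_multiples p"
proof (intro equalityI subsetI)
  fix y assume "y \<in> zmult k ` (x +o p_multiples p) + p_multiples p"
  then obtain b c where "b \<in> p_multiples p" "c \<in> p_multiples p" and y: "y = zmult k (x + b) + c"
    unfolding elt_set_plus_def set_plus_def by blast
  then have "zmult k b + c \<in> p_multiples p"
    by (intro p_multiples_add zmult_p_multiples)
  moreover have "y = zmult k x + (zmult k b + c)"
    by (simp only: y zmult_add_right add.assoc)
  ultimately show "y \<in> zmult k x +o p_multiples p"
    unfolding elt_set_plus_def by blast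
next
  fix y assume "y \<in> zmult k x +o p_multiples p"
  then obtain c where "c \<in> p_multiples p" "y = zmult k x + c"
    unfolding elt_set_plus_def by blast
  moreover have "x \<in> x +o p_multiples p"
    unfolding elt_set_plus_def using p_multiples_0[of p] by force
  ultimately show "y \<in> zmult k ` (x +o p_multiples p) + p_multiples p"
    unfolding set_plus_def by blast
qed

lemma coset_subset:
  assumes "x - y \<in> p_multiples p"
  shows "x +o p_multiples p \<subseteq> y +o p_multiples p"
proof
  fix z assume "z \<in> x +o p_multiples p"
  then obtain b where b: "b \<in> p_multiples p" "z = x + b"
    unfolding elt_set_plus_def by blast
  then have "z = y + ((x - y) + b)" by simp
  then show "z \<in> y +o p_multiples p"
    unfolding elt_set_plus_def using p_multiples_add[OF assms b(1)] by blast
qed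

lemma coset_eqI:
  assumes "x - y \<in> p_multiples p"
  shows "x +o p_multiples p = y +o p_multiples p"
  using coset_subset[OF assms] coset_subset[of y x p] p_multiples_minus[OF assms] by simp

lemma coset_mod:
  "zmult (k mod int p) x +o p_multiples p = zmult k x +o p_multiples p"
proof -
  have "zmult (k mod int p) x - zmult k x = zmult (int p) (zmult (- (k div int p)) x)"
    unfolding zmult_zmult zmod.scale_left_diff_distrib[symmetric]
    by (rule arg_cong[where f = "\<lambda>n. zmult n x"]) (simp add: minus_mult_div_eq_mod[symmetric])
  then show ?thesis by (intro coset_eqI) (simp only: p_multiples_def rangeI)
qed

lemma quotient_space_vectorspace:
  assumes "prime p"
  shows "vectorspace (residue_ring (int p)) (quotient_space p :: (int, 'a::ab_group_add set) module)"
proof -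
  interpret P: residues_prime p "residue_ring (int p)"
    using assms by unfold_locales
  let ?V = "quotient_space p :: (int, 'a set) module"
  have z: "p_multiples p = (0::'a) +o p_multiples p" by simp
  have grp: "abelian_group ?V"
  proof (rule abelian_groupI)
    fix C assume "C \<in> carrier ?V"
    then obtain x where "C = x +o p_multiples p" by (auto simp: quotient_space_def)
    then show "\<exists>D\<in>carrier ?V. D \<oplus>\<^bsub>?V\<^esub> C = \<zero>\<^bsub>?V\<^esub>"
      by (intro bexI[of _ "(- x) +o p_multiples p"]) (auto simp: quotient_space_def coset_add)
  next
    show "\<zero>\<^bsub>?V\<^esub> \<in> carrier ?V" unfolding quotient_space_def by simp (metis z rangeI)
  next
    fix C assume "C \<in> carrier ?V"
    then obtain x where "C = x +o p_multiples p" by (auto simp: quotient_space_def)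
    then show "\<zero>\<^bsub>?V\<^esub> \<oplus>\<^bsub>?V\<^esub> C = C"
      using coset_add[of 0 p x] by (simp add: quotient_space_def)
  qed (auto simp: quotient_space_def coset_add add_ac)
  have one: "(x +o p_multiples p) + p_multiples p = x +o p_multiples p" for x :: 'a
    using coset_add[of x p 0] by simp
  have "Module.module (residue_ring (int p)) ?V"
  proof (rule moduleI)
    show "cring (residue_ring (int p))" by (rule P.cring)
    show "abelian_group ?V" by (rule grp)
  qed (auto simp: quotient_space_def residue_ring_def coset_smult coset_add coset_mod
        zmult_add_left zmult_add_right zmult_zmult one)
  then show ?thesis
    by (rule vectorspace.intro) (rule P.is_field)
qed

text \<open>
  \<^const>\<open>vectorspace.dim\<close> is meaningful only in finite dimension.
\<close>

definition p_rank :: "'a::ab_group_add itself \<Rightarrow> nat \<Rightarrow> enat" where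
  "p_rank _ p =
     (let K = residue_ring (int p); V = quotient_space p :: (int, 'a set) module in
      if vectorspace.fin_dim K V then enat (vectorspace.dim K V) else \<infinity>)"

definition Murley_group :: "'a::ab_group_add itself \<Rightarrow> bool" where
  "Murley_group G \<longleftrightarrow> reduced_group G \<and> torsion_free G \<and> finite_rank G \<and>
     (\<forall>p. prime p \<longrightarrow> p_rank G p \<le> 1)"

subsection \<open>Types\<close>

definition p_height :: "nat \<Rightarrow> 'a::ab_group_add \<Rightarrow> enat" where
  "p_height p g = Sup {enat k | k. \<exists>x. g = zmult (int p ^ k) x}"

text \<open>Characteristics are indexed by the primes; other indices carry the dummy value 0.\<close>

definition characteristic :: "'a::ab_group_add \<Rightarrow> nat \<Rightarrow> enat" where
  "characteristic g = (\<lambda>p. if prime p then p_height p g else 0)"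

definition equiv_characteristics :: "(nat \<Rightarrow> enat) \<Rightarrow> (nat \<Rightarrow> enat) \<Rightarrow> bool" where
  "equiv_characteristics \<chi> \<psi> \<longleftrightarrow>
     finite {p. \<chi> p \<noteq> \<psi> p} \<and> (\<forall>p. \<chi> p \<noteq> \<psi> p \<longrightarrow> \<chi> p \<noteq> \<infinity> \<and> \<psi> p \<noteq> \<infinity>)"

definition type_of_element :: "'a::ab_group_add \<Rightarrow> (nat \<Rightarrow> enat) set" where
  "type_of_element g = {\<chi>. equiv_characteristics (characteristic g) \<chi>}"

definition homogeneous :: "'a::ab_group_add itself \<Rightarrow> bool" where
  "homogeneous _ \<longleftrightarrow>
     (\<forall>(g::'a) (h::'a). g \<noteq> 0 \<longrightarrow> h \<noteq> 0 \<longrightarrow> type_of_element g = type_of_element h)"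

subsection \<open>Rings on a group\<close>

text \<open>
  A homomorphism from the tensor square of \<open>G\<close> to \<open>G\<close> is given as the corresponding biadditive
  map. Rings need not be unital.
\<close>

definition group_multiplication :: "('a::ab_group_add \<Rightarrow> 'a \<Rightarrow> 'a) \<Rightarrow> bool" where
  "group_multiplication \<mu> \<longleftrightarrow>
     (\<forall>x y z. \<mu> (x + y) z = \<mu> x z + \<mu> y z) \<and> (\<forall>x y z. \<mu> x (y + z) = \<mu> x y + \<mu> x z)"

definition associative_multiplication :: "('a::ab_group_add \<Rightarrow> 'a \<Rightarrow> 'a) \<Rightarrow> bool" where
  "associative_multiplication \<mu> \<longleftrightarrow>
     group_multiplication \<mu> \<and> (\<forall>x y z. \<mu> (\<mu> x y) z = \<mu> x (\<mu> y z))"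

definition subring_of :: "('a::ab_group_add \<Rightarrow> 'a \<Rightarrow> 'a) \<Rightarrow> 'a set \<Rightarrow> bool" where
  "subring_of \<mu> A \<longleftrightarrow> additive_subgroup_on A \<and> (\<forall>x\<in>A. \<forall>y\<in>A. \<mu> x y \<in> A)"

definition ideal_of :: "('a::ab_group_add \<Rightarrow> 'a \<Rightarrow> 'a) \<Rightarrow> 'a set \<Rightarrow> 'a set \<Rightarrow> bool" where
  "ideal_of \<mu> I R \<longleftrightarrow> additive_subgroup_on I \<and> I \<subseteq> R \<and>
     (\<forall>r\<in>R. \<forall>x\<in>I. \<mu> r x \<in> I \<and> \<mu> x r \<in> I)"

definition meta_ideal :: "('a::ab_group_add \<Rightarrow> 'a \<Rightarrow> 'a) \<Rightarrow> 'a set \<Rightarrow> bool" where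
  "meta_ideal \<mu> A \<longleftrightarrow> subring_of \<mu> A \<and>
     (\<exists>n (C :: nat \<Rightarrow> 'a set). C 0 = A \<and> C n = UNIV \<and>
        (\<forall>i<n. subring_of \<mu> (C (Suc i)) \<and> ideal_of \<mu> (C i) (C (Suc i))))"

definition filial :: "('a::ab_group_add \<Rightarrow> 'a \<Rightarrow> 'a) \<Rightarrow> bool" where
  "filial \<mu> \<longleftrightarrow> (\<forall>A. meta_ideal \<mu> A \<longrightarrow> ideal_of \<mu> A UNIV)"

definition TI_group :: "'a::ab_group_add itself \<Rightarrow> bool" where
  "TI_group _ \<longleftrightarrow> (\<forall>\<mu> :: 'a \<Rightarrow> 'a \<Rightarrow> 'a. associative_multiplication \<mu> \<longrightarrow> filial \<mu>)"

definition nil_a_group :: "'a::ab_group_add itself \<Rightarrow> bool" where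
  "nil_a_group _ \<longleftrightarrow>
     (\<forall>\<mu> :: 'a \<Rightarrow> 'a \<Rightarrow> 'a. associative_multiplication \<mu> \<longrightarrow> (\<forall>x y. \<mu> x y = 0))"

end

theory Submission
  imports Defs
begin

text \<open>
  Two facts carry the classification, one for each direction.

  Suppose that every associative ring on \<open>G\<close> is filial, and apply this to the rescaled
  multiplication \<open>n \<mu>\<close> for an integer \<open>n \<noteq> 0\<close>. If \<open>E\<close> is a subgroup that contains all products
  \<open>\<mu> x y\<close>, then \<open>\<int>na + n\<^sup>3E\<close> is an ideal of \<open>nG\<close>, which is an ideal of the rescaled ring, so it
  is an ideal of the whole ring; this gives \<open>n (g a) \<in> \<int>a + n\<^sup>2E\<close> for all \<open>g\<close> and \<open>a\<close>
  (\<open>TI_product\<close>). The relation has two consequences.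
  \<^item> If \<open>E\<close> is pure and proper, the choice of \<open>a\<close> outside \<open>E\<close> shows that all products are divisible
    by every \<open>n\<close>; hence they vanish, as \<open>G\<close> is reduced (\<open>TI_pure_square_zero\<close>).
  \<^item> Modulo a prime \<open>p\<close>, every element of \<open>G/pG\<close> is a common eigenvector of all left and all right
    multiplications. If \<open>G/pG\<close> has dimension at least two, this forces all products into \<open>pG\<close>, and,
    after division by \<open>p\<close>, into \<open>p\<^sup>kG\<close> for all \<open>k\<close> (\<open>TI_mult_infinite_height\<close>).

  The elements of infinite \<open>p\<close>-height form a pure subgroup. So if \<open>G\<close> carries a non-zero associative
  ring, then no \<open>G/pG\<close> has dimension at least two, and \<open>G\<close> is a Murley group. Applied to the
  multiplications \<open>x c y\<close>, with \<open>c\<close> of infinite \<open>q\<close>-height, the first consequence also excludes such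
  \<open>c \<noteq> 0\<close> unless \<open>G\<close> is \<open>q\<close>-divisible (\<open>TI_finite_heights\<close>).

  Conversely, let \<open>G\<close> be a Murley group in which this last property of heights holds, as it does in
  a homogeneous one. If \<open>h\<close> is not divisible by \<open>p\<close>, then \<open>G = \<int>h + pG\<close>; so an endomorphism that
  kills a non-zero element has divisible image, and is zero (\<open>endomorphism_zero\<close>). Therefore a
  non-zero ring on \<open>G\<close> has no zero divisors, and finite rank makes every non-zero principal right
  ideal \<open>aG\<close> contain some \<open>cG\<close> with \<open>c \<noteq> 0\<close> (\<open>zmult_mem_principal\<close>). On the one hand this makes
  the heights of any two non-zero elements agree up to finitely many primes, which is homogeneity.
  On the other hand, every non-zero meta-ideal contains some \<open>cG\<close> with \<open>c \<noteq> 0\<close>, and since the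
  groups \<open>G/cG\<close> are cyclic, the subgroups that contain \<open>cG\<close> are all of the form \<open>dG\<close>, which are
  ideals (\<open>filial_if_domain\<close>).
\<close>

section \<open>Divisibility in abelian groups\<close>

definition zdvd :: "int \<Rightarrow> 'a::ab_group_add \<Rightarrow> bool" where
  "zdvd n x \<longleftrightarrow> (\<exists>y. x = zmult n y)"

lemma zdvdI: "x = zmult n y \<Longrightarrow> zdvd n x"
  by (auto simp: zdvd_def)

lemma zdvd_zmult_self [simp]: "zdvd n (zmult n x)"
  by (auto simp: zdvd_def)

lemma zdvd_0 [simp]: "zdvd n 0"
  by (rule zdvdI[of _ _ 0]) simp

lemma zdvd_1 [simp]: "zdvd 1 x"
  by (rule zdvdI[of _ _ x]) simp

lemma zdvd_add: "zdvd n x \<Longrightarrow> zdvd n y \<Longrightarrow> zdvd n (x + y)"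
  unfolding zdvd_def by (metis zmult_add_right)

lemma zdvd_minus: "zdvd n x \<Longrightarrow> zdvd n (- x)"
  unfolding zdvd_def by (metis zmod.scale_minus_right)

lemma zdvd_diff: "zdvd n x \<Longrightarrow> zdvd n y \<Longrightarrow> zdvd n (x - y)"
  using zdvd_add[of n x "- y"] zdvd_minus[of n y] by simp

lemma zdvd_zmult: "zdvd n x \<Longrightarrow> zdvd n (zmult k x)"
  unfolding zdvd_def by (metis zmult_zmult mult.commute)

lemma zdvd_zmult_dvd: "n dvd k \<Longrightarrow> zdvd n (zmult k x)"
  by (metis dvdE zdvd_zmult_self zmult_zmult)

lemma zdvd_dvd: "zdvd n x \<Longrightarrow> m dvd n \<Longrightarrow> zdvd m x"
  unfolding zdvd_def by (metis dvdE zmult_zmult)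

lemma zdvd_coprime_cancel:
  assumes "zdvd n (zmult m x)" "coprime n m"
  shows "zdvd n x"
proof -
  obtain u v where "u * n + v * m = 1"
    using assms(2) by (metis bezout_int coprime_iff_gcd_eq_1)
  then have "x = zmult (u * n) x + zmult (v * m) x"
    by (metis zmult_add_left zmult_1)
  also have "\<dots> = zmult n (zmult u x) + zmult v (zmult m x)"
    by (simp add: zmult_zmult mult.commute)
  finally show ?thesis
    using assms(1) by (metis zdvd_add zdvd_zmult zdvd_zmult_self)
qed

lemma coprime_int_prime:
  assumes "prime p" "\<not> int p dvd k" shows "coprime (int p) k"
  using assms by (simp add: prime_imp_coprime)

lemma zmult_cancel:
  assumes "torsion_free TYPE('a::ab_group_add)" "n \<noteq> 0"
  shows "zmult n x = zmult n (y::'a) \<longleftrightarrow> x = y"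
proof
  assume "zmult n x = zmult n y"
  then have "zmult n (x - y) = 0" by (simp add: zmod.scale_right_diff_distrib)
  then show "x = y" using assms unfolding torsion_free_def by (metis eq_iff_diff_eq_0)
qed simp

lemma zmult_eq_0_iff:
  assumes "torsion_free TYPE('a::ab_group_add)"
  shows "zmult n (x::'a) = 0 \<longleftrightarrow> n = 0 \<or> x = 0"
  using assms unfolding torsion_free_def by auto

lemma zdvd_cancel:
  assumes "torsion_free TYPE('a::ab_group_add)" "c \<noteq> 0" "zdvd (c * n) (zmult c (x::'a))"
  shows "zdvd n x"
  using assms(3) zmult_cancel[OF assms(1,2)] unfolding zdvd_def
  by (metis zmult_zmult)

lemma additive_zmult:
  assumes "\<And>x y. f (x + y) = f x + (f y :: 'b::ab_group_add)"
  shows "f (zmult n x) = zmult n (f (x :: 'a::ab_group_add))"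
proof -
  have 0: "f 0 = 0" using assms[of 0 0] by simp
  have d: "f (u - v) = f u - f v" for u v
    using assms[of "u - v" v] by (simp add: algebra_simps)
  show ?thesis
    by (induction n rule: int_induct[where k = 0]) (simp_all add: 0 d assms zmult_succ zmult_pred)
qed

lemma subgroup_zmult:
  assumes "additive_subgroup_on H" "x \<in> H"
  shows "zmult n x \<in> H"
proof (induction n rule: int_induct[where k = 0])
  case base
  then show ?case using assms by (simp add: additive_subgroup_on_def)
next
  case (step1 i)
  then show ?case using assms by (simp add: additive_subgroup_on_def zmult_succ)
next
  case (step2 i)
  then show ?case using assms unfolding zmult_pred
    by (metis additive_subgroup_on_def add_uminus_conv_diff)
qed

lemma subgroup_diff:
  "additive_subgroup_on H \<Longrightarrow> x \<in> H \<Longrightarrow> y \<in> H \<Longrightarrow> x - y \<in> H"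
  by (metis additive_subgroup_on_def add_uminus_conv_diff)

lemma divisible_onI_prime:
  assumes sub: "additive_subgroup_on D"
    and div: "\<And>p x. prime (p::nat) \<Longrightarrow> x \<in> D \<Longrightarrow> \<exists>y\<in>D. x = zmult (int p) y"
  shows "divisible_on D"
proof -
  have pos: "\<forall>x\<in>D. \<exists>y\<in>D. x = zmult (int n) y" if "n > 0" for n
    using that
  proof (induction n rule: less_induct)
    case (less n)
    show ?case
    proof (cases "n = 1")
      case False
      then obtain p where p: "prime p" "p dvd n" using prime_factor_nat by blast
      then obtain m where m: "n = p * m" by blast
      have "m > 0" "m < n" using m less.prems prime_gt_1_nat[OF p(1)] by auto
      show ?thesis
      proof
        fix x assume "x \<in> D"
        then obtain y where "y \<in> D" "x = zmult (int p) y" using div p by blast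
        moreover then obtain z where "z \<in> D" "y = zmult (int m) z"
          using less.IH \<open>m > 0\<close> \<open>m < n\<close> by blast
        ultimately show "\<exists>z\<in>D. x = zmult (int n) z" by (auto simp: m zmult_zmult)
      qed
    qed auto
  qed
  show ?thesis
    unfolding divisible_on_def
  proof (intro allI impI ballI)
    fix n :: int and x assume "n \<noteq> 0" "x \<in> D"
    then obtain y where y: "y \<in> D" "x = zmult (int (nat \<bar>n\<bar>)) y" using pos[of "nat \<bar>n\<bar>"] by auto
    show "\<exists>y\<in>D. x = zmult n y"
    proof (cases "n > 0")
      case False
      with y have "x = zmult n (- y)" using \<open>n \<noteq> 0\<close> by (simp add: zmult_minus_left)
      then show ?thesis using y(1) sub unfolding additive_subgroup_on_def by blast
    qed (use y in auto)
  qed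
qed

definition pure_subgroup :: "'a::ab_group_add set \<Rightarrow> bool" where
  "pure_subgroup E \<longleftrightarrow> additive_subgroup_on E \<and> (\<forall>n x. n \<noteq> 0 \<longrightarrow> zmult n x \<in> E \<longrightarrow> x \<in> E)"

definition infinite_height :: "nat \<Rightarrow> 'a::ab_group_add set" where
  "infinite_height p = {x. \<forall>k. zdvd (int p ^ k) x}"

lemma finite_height_decompose:
  assumes "x \<notin> infinite_height p"
  obtains j y where "x = zmult (int p ^ j) y" "\<not> zdvd (int p) y"
proof -
  define k where "k = (LEAST k. \<not> zdvd (int p ^ k) x)"
  have k: "\<not> zdvd (int p ^ k) x"
    unfolding k_def by (rule LeastI_ex) (use assms in \<open>auto simp: infinite_height_def\<close>)
  then obtain j where j: "k = Suc j" by (cases k) auto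
  then have "zdvd (int p ^ j) x" using not_less_Least[of j "\<lambda>k. \<not> zdvd (int p ^ k) x"]
    unfolding k_def by auto
  then obtain y where y: "x = zmult (int p ^ j) y" unfolding zdvd_def by blast
  have "\<not> zdvd (int p) y" using k unfolding j y zdvd_def by (auto simp: zmult_zmult mult.commute)
  with y show thesis by (rule that)
qed

text \<open>
  Write \<open>n = p\<^sup>j m\<close> with \<open>m\<close> prime to \<open>p\<close>. The factor \<open>p\<^sup>j\<close> cancels against divisibility by
  \<open>p\<^sup>j p\<^sup>k\<close>, and \<open>m\<close> is invertible modulo \<open>p\<^sup>k\<close>.
\<close>
lemma infinite_height_pure:
  assumes tf: "torsion_free TYPE('a::ab_group_add)" and p: "prime p"
  shows "pure_subgroup (infinite_height p :: 'a set)"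
  unfolding pure_subgroup_def
proof (intro conjI allI impI)
  show "additive_subgroup_on (infinite_height p :: 'a set)"
    unfolding additive_subgroup_on_def infinite_height_def by (auto intro: zdvd_add zdvd_minus)
next
  fix n and x :: 'a assume n: "n \<noteq> 0" and nx: "zmult n x \<in> infinite_height p"
  obtain m where m: "n = int p ^ multiplicity (int p) n * m" "\<not> int p dvd m"
    by (rule multiplicity_decompose'[of n "int p"]) (use n p in auto)
  let ?j = "multiplicity (int p) n"
  show "x \<in> infinite_height p"
    unfolding infinite_height_def
  proof safe
    fix k
    have "zdvd (int p ^ ?j * int p ^ k) (zmult (int p ^ ?j) (zmult m x))"
      using nx m(1) unfolding infinite_height_def by (simp add: zmult_zmult flip: power_add)
    then have "zdvd (int p ^ k) (zmult m x)"
      by (rule zdvd_cancel[OF tf, rotated]) (use p in auto)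
    then show "zdvd (int p ^ k) x"
      by (rule zdvd_coprime_cancel) (use coprime_int_prime[OF p m(2)] in auto)
  qed
qed

text \<open>
  The elements that have infinite height at all primes form a divisible subgroup: purity puts the
  quotient of such an element by a prime back into each of the subgroups of infinite height.
\<close>
lemma reduced_exists_non_divisor:
  fixes x :: "'a::ab_group_add"
  assumes tf: "torsion_free TYPE('a)" and red: "reduced_group TYPE('a)" and "x \<noteq> 0"
  obtains p :: nat where "prime p" "x \<notin> infinite_height p"
proof -
  define D where "D = (\<Inter>p\<in>{p. prime p}. infinite_height p :: 'a set)"
  have pure: "pure_subgroup (infinite_height p :: 'a set)" if "prime p" for p
    using infinite_height_pure[OF tf that] .
  have sub: "additive_subgroup_on D"
    using pure unfolding D_def pure_subgroup_def additive_subgroup_on_def by auto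
  moreover have "divisible_on D"
  proof (rule divisible_onI_prime[OF sub])
    fix p :: nat and y :: 'a assume p: "prime p" and y: "y \<in> D"
    then have "zdvd (int p ^ 1) y" unfolding D_def infinite_height_def by blast
    then obtain z where z: "y = zmult (int p) z" by (auto simp: zdvd_def)
    have "z \<in> infinite_height r" if "prime r" for r
    proof -
      have "int p \<noteq> 0" "zmult (int p) z \<in> infinite_height r"
        using p y that unfolding D_def z by auto
      then show ?thesis using pure[OF that] unfolding pure_subgroup_def by blast
    qed
    then have "z \<in> D" unfolding D_def by blast
    with z show "\<exists>z\<in>D. y = zmult (int p) z" by blast
  qed
  ultimately have "D = {0}" using red unfolding reduced_group_def by blast
  with \<open>x \<noteq> 0\<close> have "x \<notin> D" by simp
  then show thesis using that unfolding D_def by blast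
qed

section \<open>Groups of p-rank at most one\<close>

text \<open>
  The condition \<open>r\<^sub>p \<le> 1\<close> in terms of elements: any \<open>h\<close> outside \<open>pG\<close> generates \<open>G/pG\<close>.
\<close>
definition cyclic_mod :: "'a::ab_group_add itself \<Rightarrow> nat \<Rightarrow> bool" where
  "cyclic_mod _ p \<longleftrightarrow>
     (\<forall>h g::'a. \<not> zdvd (int p) h \<longrightarrow> (\<exists>k. zdvd (int p) (g - zmult k h)))"

lemma mem_p_multiples: "x \<in> p_multiples p \<longleftrightarrow> zdvd (int p) x"
  unfolding p_multiples_def zdvd_def by auto

lemma coset_eq_iff:
  "x +o p_multiples p = y +o p_multiples p \<longleftrightarrow> zdvd (int p) (x - y)"
proof
  assume "x +o p_multiples p = y +o p_multiples p"
  moreover have "x \<in> x +o p_multiples p"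
    unfolding elt_set_plus_def using p_multiples_0[of p] by force
  ultimately obtain b where "b \<in> p_multiples p" "x = y + b"
    unfolding elt_set_plus_def by blast
  then show "zdvd (int p) (x - y)" by (simp add: mem_p_multiples)
qed (simp add: coset_eqI mem_p_multiples)

text \<open>
  A coset outside \<open>pG\<close> is linearly independent, so it is a basis as soon as the dimension is at most
  one; conversely, one coset that generates \<open>G/pG\<close> bounds the dimension by one.
\<close>
lemma p_rank_le_1_iff:
  assumes p: "prime p"
  shows "p_rank TYPE('a::ab_group_add) p \<le> 1 \<longleftrightarrow> cyclic_mod TYPE('a) p"
proof -
  let ?K = "residue_ring (int p)" and ?V = "quotient_space p :: (int, 'a set) module"
  interpret P: residues_prime p ?K using p by unfold_locales
  interpret V: vectorspace ?K ?V by (rule quotient_space_vectorspace[OF p])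
  let ?c = "\<lambda>g::'a. g +o p_multiples p"
  have carr: "carrier ?V = range ?c" by (simp add: quotient_space_def)
  have zero: "\<zero>\<^bsub>?V\<^esub> = ?c 0" by (simp add: quotient_space_def)
  have smult: "k \<odot>\<^bsub>?V\<^esub> ?c g = ?c (zmult k g)" for k g
    by (simp add: quotient_space_def coset_smult)
  have lin: "V.lincomb a {?c h} = a (?c h) \<odot>\<^bsub>?V\<^esub> ?c h" if "a \<in> {?c h} \<rightarrow> carrier ?K" for a h
    using that unfolding V.lincomb_def by (simp add: carr smult)
  have span: "V.span {?c h} = {?c (zmult k h) | k. k \<in> carrier ?K}" for h
  proof -
    have "V.span {?c h} = {V.lincomb a {?c h} | a. a \<in> {?c h} \<rightarrow> carrier ?K}"
      by (intro V.finite_span) (auto simp: carr)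
    also have "\<dots> = {?c (zmult k h) | k. k \<in> carrier ?K}"
    proof (intro equalityI subsetI)
      fix C assume "C \<in> {V.lincomb a {?c h} | a. a \<in> {?c h} \<rightarrow> carrier ?K}"
      then show "C \<in> {?c (zmult k h) | k. k \<in> carrier ?K}" by (auto simp: lin smult)
    next
      fix C assume "C \<in> {?c (zmult k h) | k. k \<in> carrier ?K}"
      then obtain k where "C = ?c (zmult k h)" "k \<in> carrier ?K" by blast
      then have "C = V.lincomb (\<lambda>_. k) {?c h}" "(\<lambda>_. k) \<in> {?c h} \<rightarrow> carrier ?K"
        using lin[of "\<lambda>_. k" h] by (auto simp: smult)
      then show "C \<in> {V.lincomb a {?c h} | a. a \<in> {?c h} \<rightarrow> carrier ?K}" by blast
    qed
    finally show ?thesis .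
  qed
  show ?thesis
  proof
    assume "p_rank TYPE('a) p \<le> 1"
    then have fd: "V.fin_dim" and dim: "V.dim \<le> 1"
      by (auto simp: p_rank_def Let_def one_enat_def split: if_splits)
    show "cyclic_mod TYPE('a) p"
      unfolding cyclic_mod_def
    proof (intro allI impI)
      fix h g :: 'a assume h: "\<not> zdvd (int p) h"
      have "V.lin_indpt {?c h}"
      proof (rule V.finite_lin_indpt2)
        fix a assume a: "a \<in> {?c h} \<rightarrow> carrier ?K" "V.lincomb a {?c h} = \<zero>\<^bsub>?V\<^esub>"
        then have "?c (zmult (a (?c h)) h) = ?c 0" by (simp only: lin smult zero)
        then have "zdvd (int p) (zmult (a (?c h)) h)" unfolding coset_eq_iff by simp
        then have "int p dvd a (?c h)" using h coprime_int_prime[OF p] zdvd_coprime_cancel by blast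
        moreover have "0 \<le> a (?c h)" "a (?c h) < int p"
          using a(1) by (auto simp: P.res_carrier_eq)
        ultimately have "a (?c h) = 0" using zdvd_not_zless by force
        then show "\<forall>v\<in>{?c h}. a v = \<zero>\<^bsub>?K\<^esub>" by (simp add: P.res_zero_eq)
      qed (auto simp: carr)
      then have "V.basis {?c h}"
        using fd dim by (intro V.dim_li_is_basis) (auto simp: carr)
      then have "?c g \<in> V.span {?c h}" unfolding V.basis_def carr by auto
      then show "\<exists>k. zdvd (int p) (g - zmult k h)" unfolding span using coset_eq_iff by blast
    qed
  next
    assume cyc: "cyclic_mod TYPE('a) p"
    obtain h :: 'a where h: "\<And>g. \<exists>k. zdvd (int p) (g - zmult k h)"
    proof (cases "\<forall>g::'a. zdvd (int p) g")
      case True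
      then show ?thesis using that[of 0] by simp
    next
      case False
      then show ?thesis using that cyc unfolding cyclic_mod_def by blast
    qed
    have "carrier ?V \<subseteq> V.span {?c h}"
    proof
      fix C assume "C \<in> carrier ?V"
      then obtain g where g: "C = ?c g" by (auto simp: carr)
      obtain k where "zdvd (int p) (g - zmult k h)" using h by blast
      then have "C = ?c (zmult k h)" unfolding g coset_eq_iff .
      then have "C = ?c (zmult (k mod int p) h)" by (simp only: coset_mod)
      moreover have "k mod int p \<in> carrier ?K"
        using p by (simp add: P.res_carrier_eq prime_gt_0_nat)
      ultimately show "C \<in> V.span {?c h}" unfolding span by blast
    qed
    then have gen: "V.gen_set {?c h}" using V.span_is_subset2[of "{?c h}"] by (auto simp: carr)
    then have "V.dim \<le> 1" using V.gen_ge_dim[of "{?c h}"] by (auto simp: carr)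
    moreover have "V.fin_dim" unfolding V.fin_dim_def using gen
      by (intro exI[of _ "{?c h}"]) (auto simp: carr)
    ultimately show "p_rank TYPE('a) p \<le> 1"
      by (simp add: p_rank_def Let_def one_enat_def)
  qed
qed

section \<open>Multiplications and meta-ideals\<close>

lemma mult_add:
  assumes "associative_multiplication \<mu>"
  shows "\<mu> (x + y) z = \<mu> x z + \<mu> y z" "\<mu> x (y + z) = \<mu> x y + \<mu> x z"
  using assms by (simp_all add: associative_multiplication_def group_multiplication_def)

lemma mult_assoc:
  assumes "associative_multiplication \<mu>"
  shows "\<mu> (\<mu> x y) z = \<mu> x (\<mu> y z)"
  using assms by (simp add: associative_multiplication_def)

lemma mult_zmult:
  assumes "associative_multiplication \<mu>"
  shows "\<mu> (zmult n x) y = zmult n (\<mu> x y)" "\<mu> x (zmult n y) = zmult n (\<mu> x y)"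
  using additive_zmult[of "\<lambda>x. \<mu> x y" n x] additive_zmult[of "\<mu> x" n y] mult_add[OF assms] by auto

lemma mult_0:
  assumes "associative_multiplication \<mu>"
  shows "\<mu> 0 y = 0" "\<mu> x 0 = 0"
  using mult_zmult[OF assms, where n = 0] by simp_all

lemma mult_zdvd:
  assumes "associative_multiplication \<mu>"
  shows "zdvd n x \<Longrightarrow> zdvd n (\<mu> x y)" "zdvd n y \<Longrightarrow> zdvd n (\<mu> x y)"
  using mult_zmult[OF assms] unfolding zdvd_def by auto

lemma filial_if_zero:
  assumes "\<And>x y. \<mu> x y = 0"
  shows "filial \<mu>"
  using assms
  by (auto simp: filial_def meta_ideal_def subring_of_def ideal_of_def additive_subgroup_on_def)

lemma filial_ideal_of_ideal:
  assumes "filial \<mu>" "ideal_of \<mu> H B" "ideal_of \<mu> B UNIV"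
  shows "ideal_of \<mu> H UNIV"
proof -
  let ?C = "\<lambda>i::nat. if i = 0 then H else if i = 1 then B else UNIV"
  have "subring_of \<mu> H" "subring_of \<mu> B" "subring_of \<mu> UNIV"
    using assms(2,3) by (auto simp: ideal_of_def subring_of_def additive_subgroup_on_def)
  moreover have "\<forall>i<2. subring_of \<mu> (?C (Suc i)) \<and> ideal_of \<mu> (?C i) (?C (Suc i))"
    using assms(2,3) calculation by (auto simp: less_2_cases_iff)
  ultimately have "meta_ideal \<mu> H"
    unfolding meta_ideal_def by (intro conjI exI[of _ 2] exI[of _ ?C]) auto
  with assms(1) show ?thesis by (simp add: filial_def)
qed

text \<open>
  The source of all restrictions on TI-groups. In the ring with multiplication \<open>\<nu> = n \<mu>\<close>, the
  product of \<open>ns\<close> and \<open>ny\<close> is \<open>n\<^sup>3 (s y)\<close>, so it lies in \<open>n\<^sup>3E\<close>. Hence each subgroup between \<open>n\<^sup>3E\<close> and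
  \<open>nG\<close> is an ideal of the ideal \<open>nG\<close>. Filiality, for the smallest such subgroup \<open>H\<close> that contains
  \<open>na\<close>, says that \<open>n\<^sup>2 (g a)\<close> and \<open>n\<^sup>2 (a g)\<close> lie in \<open>H\<close>; a factor \<open>n\<close> cancels.
\<close>
lemma TI_product:
  fixes \<mu> :: "'a::ab_group_add \<Rightarrow> 'a \<Rightarrow> 'a"
  assumes TI: "TI_group TYPE('a)" and tf: "torsion_free TYPE('a)"
    and \<mu>: "associative_multiplication \<mu>"
    and E: "additive_subgroup_on E" "\<And>x y. \<mu> x y \<in> E" and n: "n \<noteq> 0"
  shows "\<exists>k. \<exists>e\<in>E. zmult n (\<mu> g a) = zmult k a + zmult (n * n) e"
    and "\<exists>k. \<exists>e\<in>E. zmult n (\<mu> a g) = zmult k a + zmult (n * n) e"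
proof -
  define \<nu> where "\<nu> x y = zmult n (\<mu> x y)" for x y
  define B where "B = range (zmult n :: 'a \<Rightarrow> 'a)"
  define H where "H = {zmult n (zmult k a + zmult (n * n) e) | k e. e \<in> E}"
  note [simp] = mult_zmult[OF \<mu>] mult_add[OF \<mu>] zmult_zmult
  have "associative_multiplication \<nu>"
    unfolding associative_multiplication_def group_multiplication_def \<nu>_def
    by (simp add: zmult_add_right mult_assoc[OF \<mu>])
  then have filial: "filial \<nu>" using TI by (simp add: TI_group_def)
  have E0: "0 \<in> E" using E(1) by (simp add: additive_subgroup_on_def)
  have subH: "additive_subgroup_on H"
    unfolding additive_subgroup_on_def
  proof (intro conjI ballI)
    show "0 \<in> H" unfolding H_def using E0 by (intro CollectI exI[of _ 0] exI[of _ 0]) simp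
  next
    fix x y assume "x \<in> H" "y \<in> H"
    then obtain k e l f where "x = zmult n (zmult k a + zmult (n * n) e)" "e \<in> E"
      "y = zmult n (zmult l a + zmult (n * n) f)" "f \<in> E" unfolding H_def by blast
    moreover from this have "e + f \<in> E" using E(1) by (simp add: additive_subgroup_on_def)
    ultimately show "x + y \<in> H" unfolding H_def
      by (intro CollectI exI[of _ "k + l"] exI[of _ "e + f"])
        (simp add: zmult_add_left zmult_add_right distrib_left del: zmult_zmult)
  next
    fix x assume "x \<in> H"
    then obtain k e where "x = zmult n (zmult k a + zmult (n * n) e)" "e \<in> E"
      unfolding H_def by blast
    moreover from this have "- e \<in> E" using E(1) by (simp add: additive_subgroup_on_def)
    ultimately show "- x \<in> H" unfolding H_def
      by (intro CollectI exI[of _ "- k"] exI[of _ "- e"])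
        (simp add: zmult_minus_left zmult_add_right zmod.scale_right_diff_distrib)
  qed
  have HI: "zmult (n * (n * n)) e \<in> H" if "e \<in> E" for e
    unfolding H_def using that by (intro CollectI exI[of _ 0] exI[of _ e]) simp
  have subB: "additive_subgroup_on B"
    unfolding additive_subgroup_on_def B_def
    by (auto simp flip: zmult_add_right zmod.scale_minus_right intro: range_eqI[of _ _ 0])
  have "ideal_of \<nu> B UNIV"
    unfolding ideal_of_def using subB by (auto simp: B_def \<nu>_def simp flip: zmult_zmult)
  moreover have "ideal_of \<nu> H B"
    unfolding ideal_of_def
  proof (intro conjI ballI subH)
    show "H \<subseteq> B" unfolding H_def B_def by blast
  next
    fix r x assume "r \<in> B" "x \<in> H"
    then obtain s y where r: "r = zmult n s" and x: "x = zmult n y" unfolding B_def H_def by blast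
    show "\<nu> r x \<in> H" using HI[OF E(2)[of s y]] by (simp add: \<nu>_def r x mult.assoc)
    show "\<nu> x r \<in> H" using HI[OF E(2)[of y s]] by (simp add: \<nu>_def r x mult.assoc)
  qed
  ultimately have "ideal_of \<nu> H UNIV"
    using filial_ideal_of_ideal[OF filial] by blast
  moreover have "zmult n a \<in> H"
    unfolding H_def using E0 by (intro CollectI exI[of _ 1] exI[of _ 0]) simp
  ultimately have "\<nu> g (zmult n a) \<in> H" "\<nu> (zmult n a) g \<in> H"
    unfolding ideal_of_def by blast+
  then have "zmult n (zmult n (\<mu> g a)) \<in> H" "zmult n (zmult n (\<mu> a g)) \<in> H"
    by (simp_all add: \<nu>_def)
  then show "\<exists>k. \<exists>e\<in>E. zmult n (\<mu> g a) = zmult k a + zmult (n * n) e"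
    "\<exists>k. \<exists>e\<in>E. zmult n (\<mu> a g) = zmult k a + zmult (n * n) e"
    unfolding H_def zmult_cancel[OF tf n] mem_Collect_eq by blast+
qed

text \<open>
  Let \<open>a\<close> lie outside \<open>E\<close>. In \<open>n (g a) = k a + n\<^sup>2 e\<close> all terms but \<open>k a\<close> are in \<open>E\<close>, so purity forces
  \<open>k = 0\<close>, and \<open>g a\<close> is divisible by \<open>n\<close>. The elements outside a proper subgroup generate the group,
  so all products are divisible by all integers.
\<close>
lemma TI_pure_square_zero:
  fixes \<mu> :: "'a::ab_group_add \<Rightarrow> 'a \<Rightarrow> 'a"
  assumes TI: "TI_group TYPE('a)" and tf: "torsion_free TYPE('a)" and red: "reduced_group TYPE('a)"
    and \<mu>: "associative_multiplication \<mu>"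
    and E: "pure_subgroup E" "\<And>x y. \<mu> x y \<in> E" "E \<noteq> UNIV"
  shows "\<mu> x y = 0"
proof -
  have sub: "additive_subgroup_on E" using E(1) by (simp add: pure_subgroup_def)
  have out: "zdvd n (\<mu> g a)" if n: "n \<noteq> 0" and a: "a \<notin> E" for n g a
  proof -
    obtain k e where e: "e \<in> E" "zmult n (\<mu> g a) = zmult k a + zmult (n * n) e"
      using TI_product(1)[OF TI tf \<mu> sub E(2) n] by blast
    then have "zmult k a = zmult n (\<mu> g a) - zmult (n * n) e" by simp
    also have "\<dots> \<in> E" by (intro subgroup_diff subgroup_zmult sub E(2) e(1))
    finally have "k = 0" using a E(1) unfolding pure_subgroup_def by blast
    then have "zmult n (\<mu> g a) = zmult n (zmult n e)" using e(2) by (simp add: zmult_zmult)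
    then have "\<mu> g a = zmult n e" by (simp only: zmult_cancel[OF tf n])
    then show ?thesis by simp
  qed
  obtain b where b: "b \<notin> E" using E(3) by blast
  have all: "zdvd n (\<mu> x y)" if n: "n \<noteq> 0" for n
  proof (cases "y \<in> E")
    case True
    then have "y + b \<notin> E" using b subgroup_diff[OF sub, of "y + b" y] by auto
    then have "zdvd n (\<mu> x (y + b) - \<mu> x b)" using out[OF n] b by (intro zdvd_diff)
    then show ?thesis by (simp add: mult_add[OF \<mu>])
  qed (use out n in blast)
  show ?thesis
  proof (rule ccontr)
    assume "\<mu> x y \<noteq> 0"
    then obtain p where "prime p" "\<mu> x y \<notin> infinite_height p"
      using reduced_exists_non_divisor[OF tf red] by blast
    then show False using all by (auto simp: infinite_height_def)
  qed
qed

section \<open>TI-groups with a non-zero ring\<close>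

text \<open>
  With \<open>E = G\<close> and \<open>n = p\<close>, \<open>TI_product\<close> makes each element an eigenvector modulo \<open>p\<close> of left and of
  right multiplications. So a product \<open>x y\<close> is congruent both to a multiple of \<open>x\<close> and to one of \<open>y\<close>,
  and is zero in \<open>G/pG\<close> if \<open>x\<close> and \<open>y\<close> are independent there. In dimension at least two there is
  some \<open>z\<close> independent of \<open>x\<close>, and \<open>x x = x (z + x) - x z\<close> settles the dependent case.
\<close>
lemma TI_zdvd_mult:
  fixes \<mu> :: "'a::ab_group_add \<Rightarrow> 'a \<Rightarrow> 'a"
  assumes TI: "TI_group TYPE('a)" and tf: "torsion_free TYPE('a)"
    and \<mu>: "associative_multiplication \<mu>"
    and p: "prime p" and noncyc: "\<not> cyclic_mod TYPE('a) p"
  shows "zdvd (int p) (\<mu> x y)"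
proof -
  have p0: "int p \<noteq> 0" using p by auto
  \<comment> \<open>Integers prime to \<open>p\<close> act invertibly modulo \<open>p\<close>.\<close>
  have bez: "\<exists>u v. u * int p + v * k = 1" if "\<not> int p dvd k" for k
    using coprime_int_prime[OF p that] by (metis bezout_int coprime_iff_gcd_eq_1)
  have eig: "\<exists>k. zdvd (int p) (z - zmult k a)"
    if a: "\<not> zdvd (int p) a" and z: "zmult (int p) z = zmult k a + zmult (int p * int p) e" for z a e :: 'a and k
  proof -
    have "zmult k a = zmult (int p) (z - zmult (int p) e)"
      using z by (simp add: zmod.scale_right_diff_distrib zmult_zmult)
    then have "zdvd (int p) (zmult k a)" by simp
    then have "int p dvd k" using a coprime_int_prime[OF p] zdvd_coprime_cancel by blast
    then obtain l where "k = int p * l" by blast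
    with z have "zmult (int p) z = zmult (int p) (zmult l a + zmult (int p) e)"
      by (simp add: zmult_add_right zmult_zmult)
    then have "z = zmult l a + zmult (int p) e" by (simp only: zmult_cancel[OF tf p0])
    then have "z - zmult l a = zmult (int p) e" by simp
    then show ?thesis using zdvd_zmult_self by metis
  qed
  have sub: "additive_subgroup_on (UNIV :: 'a set)" by (simp add: additive_subgroup_on_def)
  have left: "\<exists>k. zdvd (int p) (\<mu> g a - zmult k a)" if "\<not> zdvd (int p) a" for g a
    using TI_product(1)[OF TI tf \<mu> sub UNIV_I p0, of g a] eig[OF that] by blast
  have right: "\<exists>k. zdvd (int p) (\<mu> a g - zmult k a)" if "\<not> zdvd (int p) a" for g a
    using TI_product(2)[OF TI tf \<mu> sub UNIV_I p0, of a g] eig[OF that] by blast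
  have indep: "zdvd (int p) (\<mu> x y)"
    if x: "\<not> zdvd (int p) x" and y: "\<not> zdvd (int p) y"
      and xy: "\<And>k. \<not> zdvd (int p) (x - zmult k y)" for x y
  proof -
    obtain k where k: "zdvd (int p) (\<mu> x y - zmult k y)" using left[OF y] by blast
    obtain l where l: "zdvd (int p) (\<mu> x y - zmult l x)" using right[OF x] by blast
    have "int p dvd l"
    proof (rule ccontr)
      assume "\<not> int p dvd l"
      then obtain u v where uv: "u * int p + v * l = 1" using bez by blast
      have "x = zmult (u * int p) x + zmult (v * l) x"
        unfolding zmult_add_left[symmetric] uv by simp
      then have "x - zmult (v * k) y = zmult (u * int p) x +
          zmult v ((\<mu> x y - zmult k y) - (\<mu> x y - zmult l x))"
        by (simp add: zmod.scale_right_diff_distrib zmult_zmult algebra_simps)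
      moreover have "zdvd (int p) \<dots>"
        by (intro zdvd_add zdvd_zmult zdvd_diff zdvd_zmult_dvd k l) simp
      ultimately show False using xy by metis
    qed
    then have "zdvd (int p) (zmult l x)" by (rule zdvd_zmult_dvd)
    with l show ?thesis by (metis zdvd_add diff_add_cancel)
  qed
  \<comment> \<open>Linear dependence modulo \<open>p\<close> is symmetric on elements outside \<open>pG\<close>.\<close>
  have sym: "\<exists>l. zdvd (int p) (x - zmult l z)"
    if z: "\<not> zdvd (int p) z" and k: "zdvd (int p) (z - zmult k x)" for x z :: 'a and k
  proof -
    have "\<not> int p dvd k"
    proof
      assume "int p dvd k"
      then have "zdvd (int p) (zmult k x)" by (rule zdvd_zmult_dvd)
      with k z show False by (metis zdvd_add diff_add_cancel)
    qed
    then obtain u v where uv: "u * int p + v * k = 1" using bez by blast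
    have "x = zmult (u * int p) x + zmult (v * k) x"
      unfolding zmult_add_left[symmetric] uv by simp
    then have "x - zmult v z = zmult (u * int p) x - zmult v (z - zmult k x)"
      by (simp add: zmod.scale_right_diff_distrib zmult_zmult algebra_simps)
    moreover have "zdvd (int p) \<dots>" by (intro zdvd_diff zdvd_zmult zdvd_zmult_dvd k) simp
    ultimately show ?thesis by metis
  qed
  have square: "zdvd (int p) (\<mu> x x)" for x
  proof (cases "zdvd (int p) x")
    case False
    have "\<exists>z. \<forall>k. \<not> zdvd (int p) (z - zmult k x)"
    proof (rule ccontr)
      assume "\<nexists>z. \<forall>k. \<not> zdvd (int p) (z - zmult k x)"
      then have gen: "\<exists>k. zdvd (int p) (z - zmult k x)" for z by blast
      obtain h g :: 'a where h: "\<not> zdvd (int p) h" and g: "\<And>k. \<not> zdvd (int p) (g - zmult k h)"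
        using noncyc unfolding cyclic_mod_def by blast
      obtain l where l: "zdvd (int p) (x - zmult l h)" using gen[of h] sym[OF h] by blast
      obtain m where m: "zdvd (int p) (g - zmult m x)" using gen by blast
      have "g - zmult (m * l) h = (g - zmult m x) + zmult m (x - zmult l h)"
        by (simp add: zmod.scale_right_diff_distrib zmult_zmult)
      moreover have "zdvd (int p) \<dots>" by (intro zdvd_add zdvd_zmult m l)
      ultimately show False using g by metis
    qed
    then obtain z where z: "\<And>k. \<not> zdvd (int p) (z - zmult k x)" by blast
    have z': "\<not> zdvd (int p) ((z + x) - zmult k x)" for k
      using z[of "k - 1"] by (simp add: zmult_pred algebra_simps)
    have prod: "zdvd (int p) (\<mu> x w)" if w: "\<And>k. \<not> zdvd (int p) (w - zmult k x)" for w
      using False w[of 0] sym[OF False] w by (intro indep) auto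
    show ?thesis using zdvd_diff[OF prod[OF z'] prod[OF z]] by (simp add: mult_add[OF \<mu>])
  qed (rule mult_zdvd[OF \<mu>])
  show ?thesis
  proof (cases "zdvd (int p) x \<or> zdvd (int p) y \<or> (\<forall>k. \<not> zdvd (int p) (x - zmult k y))")
    case True
    then show ?thesis using indep mult_zdvd[OF \<mu>] by blast
  next
    case False
    then obtain k where "zdvd (int p) (x - zmult k y)" by blast
    then have "zdvd (int p) (\<mu> (x - zmult k y) y + zmult k (\<mu> y y))"
      by (intro zdvd_add zdvd_zmult square mult_zdvd[OF \<mu>])
    moreover have "\<mu> x y = \<mu> (x - zmult k y) y + zmult k (\<mu> y y)"
      unfolding mult_zmult(1)[OF \<mu>, symmetric] mult_add(1)[OF \<mu>, symmetric] by simp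
    ultimately show ?thesis by simp
  qed
qed

text \<open>
  The previous lemma holds for all associative multiplications at once, so it can be iterated:
  a multiplication with all products in \<open>pG\<close> is \<open>p\<close> times another associative multiplication.
\<close>
lemma TI_mult_infinite_height:
  fixes \<mu> :: "'a::ab_group_add \<Rightarrow> 'a \<Rightarrow> 'a"
  assumes TI: "TI_group TYPE('a)" and tf: "torsion_free TYPE('a)"
    and \<mu>: "associative_multiplication \<mu>"
    and p: "prime p" and noncyc: "\<not> cyclic_mod TYPE('a) p"
  shows "zdvd (int p ^ k) (\<mu> x y)"
  using \<mu>
proof (induction k arbitrary: \<mu> x y)
  case (Suc k)
  have p0: "int p \<noteq> 0" using p by auto
  have "\<exists>\<nu>. \<forall>x y. \<mu> x y = zmult (int p) (\<nu> x y)"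
    using TI_zdvd_mult[OF TI tf Suc.prems p noncyc] unfolding zdvd_def by metis
  then obtain \<nu> where \<nu>: "\<And>x y. \<mu> x y = zmult (int p) (\<nu> x y)" by blast
  have "associative_multiplication \<nu>"
    unfolding associative_multiplication_def group_multiplication_def
  proof (intro conjI allI)
    fix x y z
    show "\<nu> (x + y) z = \<nu> x z + \<nu> y z" "\<nu> x (y + z) = \<nu> x y + \<nu> x z"
      using mult_add[OF Suc.prems] unfolding \<nu> zmult_add_right[symmetric] zmult_cancel[OF tf p0] .
    have "\<mu> (\<nu> x y) z = \<mu> x (\<nu> y z)"
      using mult_assoc[OF Suc.prems, of x y z]
      unfolding \<nu>[of x y] \<nu>[of y z] mult_zmult[OF Suc.prems] zmult_cancel[OF tf p0] .
    then show "\<nu> (\<nu> x y) z = \<nu> x (\<nu> y z)" unfolding \<nu> zmult_cancel[OF tf p0] .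
  qed
  from Suc.IH[OF this, of x y] show ?case by (auto simp: \<nu> zdvd_def zmult_zmult)
qed simp

lemma TI_cyclic_mod:
  fixes \<mu> :: "'a::ab_group_add \<Rightarrow> 'a \<Rightarrow> 'a"
  assumes TI: "TI_group TYPE('a)" and tf: "torsion_free TYPE('a)" and red: "reduced_group TYPE('a)"
    and \<mu>: "associative_multiplication \<mu>" and nz: "\<mu> a b \<noteq> 0" and p: "prime p"
  shows "cyclic_mod TYPE('a) p"
proof (rule ccontr)
  assume noncyc: "\<not> cyclic_mod TYPE('a) p"
  have "infinite_height p = (UNIV :: 'a set)"
    using TI_pure_square_zero[OF TI tf red \<mu> infinite_height_pure[OF tf p]] nz
      TI_mult_infinite_height[OF TI tf \<mu> p noncyc] unfolding infinite_height_def by blast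
  then have "zdvd (int p ^ 1) x" for x :: 'a unfolding infinite_height_def by blast
  then show False using noncyc unfolding cyclic_mod_def by simp
qed

text \<open>
  What homogeneity contributes to the structure of rings on a Murley group: the \<open>p\<close>-adic topology is
  Hausdorff for every prime \<open>p\<close> by which the group is not divisible.
\<close>
definition finite_heights :: "'a::ab_group_add itself \<Rightarrow> bool" where
  "finite_heights _ \<longleftrightarrow>
     (\<forall>p (g::'a) (h::'a). prime p \<longrightarrow> \<not> zdvd (int p) g \<longrightarrow> h \<in> infinite_height p \<longrightarrow> h = 0)"

lemma sandwich_associative:
  assumes \<mu>: "associative_multiplication \<mu>"
  shows "associative_multiplication (\<lambda>x y. \<mu> (\<mu> x c) y)"
  unfolding associative_multiplication_def group_multiplication_def
  by (simp add: mult_add[OF \<mu>] mult_assoc[OF \<mu>])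

text \<open>
  Let \<open>d \<noteq> 0\<close> have infinite \<open>q\<close>-height although \<open>G \<noteq> qG\<close>. The multiplication \<open>x c y\<close>, for fixed \<open>c\<close> of
  infinite \<open>q\<close>-height, has its products in a proper pure subgroup, so \<open>x c y = 0\<close>. Since \<open>G\<close> is
  reduced, some such \<open>c = h\<close> is not divisible by some prime \<open>p\<close>, and \<open>G = \<int>h + p\<^sup>kG\<close> for all \<open>k\<close>.
  Now \<open>x c y\<close> has infinite \<open>p\<close>-height for every \<open>c\<close>, so by the same argument it is zero for every \<open>c\<close>.
  But then all products lie in the left annihilator, which is pure and hence cannot be proper.
\<close>
lemma TI_finite_heights:
  fixes \<mu> :: "'a::ab_group_add \<Rightarrow> 'a \<Rightarrow> 'a"
  assumes TI: "TI_group TYPE('a)" and tf: "torsion_free TYPE('a)" and red: "reduced_group TYPE('a)"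
    and \<mu>: "associative_multiplication \<mu>" and nz: "\<mu> a b \<noteq> 0"
  shows "finite_heights TYPE('a)"
  unfolding finite_heights_def
proof (intro allI impI, rule ccontr)
  fix q and g d :: 'a
  assume q: "prime q" and g: "\<not> zdvd (int q) g" and d: "d \<in> infinite_height q" "d \<noteq> 0"
  have proper: "infinite_height r \<noteq> (UNIV :: 'a set)" if "\<not> zdvd (int r) x" for r and x :: 'a
  proof -
    have "x \<notin> infinite_height r" using that unfolding infinite_height_def
      by (metis (mono_tags, lifting) mem_Collect_eq power_one_right)
    then show ?thesis by blast
  qed
  have sandwich: "\<mu> (\<mu> x c) y = 0"
    if r: "prime r" and w: "\<not> zdvd (int r) (w::'a)"
      and c: "\<And>x y. \<mu> (\<mu> x c) y \<in> infinite_height r" for r c w x y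
    using TI_pure_square_zero[OF TI tf red sandwich_associative[OF \<mu>]
        infinite_height_pure[OF tf r] c proper[OF w]] .
  have zero_D: "\<mu> (\<mu> x c) y = 0" if "c \<in> infinite_height q" for c x y
  proof (rule sandwich[OF q g])
    show "\<mu> (\<mu> u c) v \<in> infinite_height q" for u v
      using that mult_zdvd[OF \<mu>] unfolding infinite_height_def by blast
  qed
  obtain p where p: "prime p" "d \<notin> infinite_height p"
    using reduced_exists_non_divisor[OF tf red d(2)] .
  then obtain j h where h: "d = zmult (int p ^ j) h" "\<not> zdvd (int p) h"
    using finite_height_decompose by blast
  have "int p ^ j \<noteq> 0" using p by auto
  then have hD: "h \<in> infinite_height q"
    using infinite_height_pure[OF tf q] d(1) unfolding h(1) pure_subgroup_def by blast
  have gen: "\<exists>m. zdvd (int p ^ k) (x - zmult m h)" for k and x :: 'a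
  proof (induction k arbitrary: x)
    case (Suc k)
    obtain m y where y: "x - zmult m h = zmult (int p) y"
      using TI_cyclic_mod[OF TI tf red \<mu> nz p(1)] h(2) unfolding cyclic_mod_def zdvd_def by blast
    obtain l z where z: "y - zmult l h = zmult (int p ^ k) z" using Suc unfolding zdvd_def by blast
    have "x - zmult (m + int p * l) h = (x - zmult m h) - zmult (int p) (zmult l h)"
      by (simp add: zmult_add_left zmult_zmult)
    also have "\<dots> = zmult (int p) (y - zmult l h)"
      by (simp add: y zmod.scale_right_diff_distrib)
    also have "\<dots> = zmult (int p ^ Suc k) z" by (simp add: z zmult_zmult)
    finally show ?case unfolding zdvd_def by blast
  qed simp
  have "\<mu> (\<mu> x c) y \<in> infinite_height p" for x c y
    unfolding infinite_height_def
  proof safe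
    fix k
    obtain m where m: "zdvd (int p ^ k) (c - zmult m h)" using gen by blast
    have "\<mu> (\<mu> x c) y = \<mu> (\<mu> x ((c - zmult m h) + zmult m h)) y" by simp
    also have "\<dots> = \<mu> (\<mu> x (c - zmult m h)) y + zmult m (\<mu> (\<mu> x h) y)"
      by (simp only: mult_zmult[OF \<mu>] mult_add[OF \<mu>])
    finally show "zdvd (int p ^ k) (\<mu> (\<mu> x c) y)"
      using m by (simp add: zero_D[OF hD] mult_zdvd[OF \<mu>])
  qed
  then have cube: "\<mu> (\<mu> x c) y = 0" for x c y using sandwich[OF p(1) h(2)] by blast
  define A where "A = {x. \<forall>y. \<mu> x y = 0}"
  have "pure_subgroup A"
    unfolding pure_subgroup_def additive_subgroup_on_def A_def
    using additive_zmult[of "\<lambda>x. \<mu> x y" "-1" for y] mult_add[OF \<mu>]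
    by (auto simp: mult_0[OF \<mu>] mult_zmult[OF \<mu>] zmult_eq_0_iff[OF tf] zmult_minus_left)
  then have "A = UNIV" using TI_pure_square_zero[OF TI tf red \<mu>, of A] cube nz unfolding A_def by blast
  then show False using nz unfolding A_def by blast
qed

section \<open>Rings on Murley groups with finite heights\<close>

text \<open>
  If \<open>G \<noteq> pG\<close>, then \<open>h\<close> divided by its largest possible power of \<open>p\<close> is a generator \<open>h'\<close> of \<open>G\<close> modulo
  \<open>pG\<close>, still killed by \<open>f\<close>. Hence \<open>f G = f (\<int>h' + pG) = p f G\<close>: the image is divisible.
\<close>
lemma endomorphism_zero:
  fixes f :: "'a::ab_group_add \<Rightarrow> 'a"
  assumes tf: "torsion_free TYPE('a)" and red: "reduced_group TYPE('a)"
    and cyc: "\<And>p. prime p \<Longrightarrow> cyclic_mod TYPE('a) p" and fin: "finite_heights TYPE('a)"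
    and add: "\<And>x y. f (x + y) = f x + f y" and h: "f h = 0" "h \<noteq> 0"
  shows "f x = 0"
proof -
  have zm: "f (zmult n x) = zmult n (f x)" for n x by (rule additive_zmult[OF add])
  have sub: "additive_subgroup_on (range f)"
    using zm[of 0] zm[of "-1"] unfolding additive_subgroup_on_def
    by (auto simp: zmult_minus_left simp flip: add intro: range_eqI[of _ _ 0]) (metis rangeI)
  have "divisible_on (range f)"
  proof (rule divisible_onI_prime[OF sub])
    fix p :: nat and z assume p: "prime p" and "z \<in> range f"
    then obtain x where z: "z = f x" by blast
    have "\<exists>y. f x = zmult (int p) (f y)"
    proof (cases "\<forall>g::'a. zdvd (int p) g")
      case True
      then show ?thesis using zm unfolding zdvd_def by metis
    next
      case False
      then have "h \<notin> infinite_height p"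
        using fin p h(2) unfolding finite_heights_def by blast
      then obtain j h' where h': "h = zmult (int p ^ j) h'" "\<not> zdvd (int p) h'"
        using finite_height_decompose by blast
      then have "f h' = 0" using h(1) p by (simp add: zm zmult_eq_0_iff[OF tf])
      obtain k y where "x - zmult k h' = zmult (int p) y"
        using cyc[OF p] h'(2) unfolding cyclic_mod_def zdvd_def by blast
      then have "x = zmult (int p) y + zmult k h'" by (simp add: diff_eq_eq)
      then show ?thesis using \<open>f h' = 0\<close> by (auto simp: add zm)
    qed
    then show "\<exists>y\<in>range f. z = zmult (int p) y" using z by blast
  qed
  then have "range f = {0}" using red sub unfolding reduced_group_def by blast
  then show ?thesis by blast
qed

text \<open>
  If \<open>x y = 0\<close> with \<open>x, y \<noteq> 0\<close>, then left multiplication by \<open>x\<close> kills \<open>y\<close>, so it is zero; then every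
  right multiplication kills \<open>x\<close>, so all of them are zero.
\<close>
lemma no_zero_divisors:
  fixes \<mu> :: "'a::ab_group_add \<Rightarrow> 'a \<Rightarrow> 'a"
  assumes tf: "torsion_free TYPE('a)" and red: "reduced_group TYPE('a)"
    and cyc: "\<And>p. prime p \<Longrightarrow> cyclic_mod TYPE('a) p" and fin: "finite_heights TYPE('a)"
    and \<mu>: "associative_multiplication \<mu>" and nz: "\<mu> a b \<noteq> 0" and xy: "\<mu> x y = 0"
  shows "x = 0 \<or> y = 0"
proof (rule ccontr)
  assume "\<not> (x = 0 \<or> y = 0)"
  then have "x \<noteq> 0" "y \<noteq> 0" by auto
  note zero = endomorphism_zero[OF tf red cyc fin]
  have "\<mu> x v = 0" for v
    using zero[of "\<mu> x" y] mult_add[OF \<mu>] xy \<open>y \<noteq> 0\<close> by blast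
  then have "\<mu> u v = 0" for u v
    using zero[of "\<lambda>u. \<mu> u v" x] mult_add[OF \<mu>] \<open>x \<noteq> 0\<close> by blast
  with nz show False by blast
qed

text \<open>
  A bound on the size of independent sets, restated for sequences, whose terms may repeat.
\<close>
lemma finite_rank_relation:
  fixes f :: "nat \<Rightarrow> 'a::ab_group_add"
  assumes "finite_rank TYPE('a)"
  obtains c n where "(\<Sum>i\<le>n. zmult (c i) (f i)) = 0" "\<exists>i\<le>n. c i \<noteq> 0"
proof -
  obtain n where n: "\<And>B::'a set. zmod.independent B \<Longrightarrow> card B \<le> n"
    using assms unfolding finite_rank_def by blast
  show thesis
  proof (cases "inj_on f {..n}")
    case True
    then have "zmod.dependent (f ` {..n})" using n[of "f ` {..n}"] by (auto simp: card_image)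
    then obtain t u where t: "t \<subseteq> f ` {..n}" "(\<Sum>v\<in>t. zmult (u v) v) = 0" "\<exists>v\<in>t. u v \<noteq> 0"
      unfolding zmod.dependent_explicit by blast
    define c where "c i = (if f i \<in> t then u (f i) else 0)" for i
    have "(\<Sum>i\<le>n. zmult (c i) (f i)) = (\<Sum>v\<in>f ` {..n}. zmult (if v \<in> t then u v else 0) v)"
      unfolding c_def by (simp add: sum.reindex[OF True])
    also have "\<dots> = (\<Sum>v\<in>t. zmult (u v) v)"
      using t(1) by (intro sum.mono_neutral_cong_right) auto
    finally show thesis
      using t that[of c n] unfolding c_def by force
  next
    case False
    then obtain i j where ij: "i \<le> n" "j \<le> n" "i \<noteq> j" "f i = f j" unfolding inj_on_def by auto
    define c where "c k = (if k = i then 1 else 0) - (if k = j then 1 else (0::int))" for k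
    have if_zmult: "zmult (if b then 1 else 0) x = (if b then x else 0)" for b and x :: 'a by simp
    have "(\<Sum>k\<le>n. zmult (c k) (f k)) = 0"
      using ij unfolding c_def
      by (simp add: zmod.scale_left_diff_distrib sum_subtractf if_zmult)
    moreover have "c i \<noteq> 0" using ij by (simp add: c_def)
    ultimately show thesis using that ij(1) by blast
  qed
qed

lemma additive_sum:
  assumes "\<And>x y. f (x + y) = f x + (f y :: 'b::ab_group_add)"
  shows "f (\<Sum>i\<in>A. g i :: 'a::ab_group_add) = (\<Sum>i\<in>A. f (g i))"
proof -
  have "f 0 = 0" using assms[of 0 0] by simp
  then show ?thesis by (induction A rule: infinite_finite_induct) (simp_all add: assms)
qed

text \<open>
  The integer \<open>c\<close> is the lowest coefficient of an integral relation between the powers of \<open>a\<close>. After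
  cancellation of powers of \<open>a\<close>, the relation reads \<open>c a + a s = 0\<close> with \<open>s\<close> in the span of the powers
  of \<open>a\<close>. Multiplying by \<open>r\<close> from the right and cancelling \<open>a\<close> gives \<open>c r = - s r\<close>, which is in \<open>aG\<close>.
  The ring may lack a unit, which is why \<open>s r\<close> appears instead of \<open>s\<close>.
\<close>
lemma zmult_mem_principal:
  fixes \<mu> :: "'a::ab_group_add \<Rightarrow> 'a \<Rightarrow> 'a"
  assumes rank: "finite_rank TYPE('a)" and \<mu>: "associative_multiplication \<mu>"
    and dom: "\<And>x y. \<mu> x y = 0 \<Longrightarrow> x = 0 \<or> y = 0" and tf: "torsion_free TYPE('a)"
    and a: "a \<noteq> 0"
  obtains c where "c \<noteq> 0" "\<And>r. \<exists>y. zmult c r = \<mu> a y"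
proof -
  \<comment> \<open>The power with exponent \<open>i + 1\<close>.\<close>
  define pw where "pw i = (\<mu> a ^^ i) a" for i
  have pw: "pw 0 = a" "pw (Suc i) = \<mu> a (pw i)" for i by (simp_all add: pw_def)
  note sum_right = additive_sum[of "\<mu> x" for x, OF mult_add(2)[OF \<mu>]]
  note sum_left = additive_sum[of "\<lambda>x. \<mu> x y" for y, OF mult_add(1)[OF \<mu>]]
  have pw_mult: "\<exists>y. \<mu> (pw i) r = \<mu> a y" for i r
    by (cases i) (auto simp: pw mult_assoc[OF \<mu>])
  have span_mult: "\<exists>y. \<mu> (\<Sum>i\<in>A. zmult (c i) (pw i)) r = \<mu> a y" for A c r
  proof -
    have "\<exists>y. \<forall>i. \<mu> (pw i) r = \<mu> a (y i)" by (rule choice) (use pw_mult in blast)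
    then obtain y where "\<And>i. \<mu> (pw i) r = \<mu> a (y i)" by blast
    then have "\<mu> (\<Sum>i\<in>A. zmult (c i) (pw i)) r = \<mu> a (\<Sum>i\<in>A. zmult (c i) (y i))"
      by (simp add: sum_left sum_right mult_zmult[OF \<mu>])
    then show ?thesis by blast
  qed
  have rel: "\<exists>m. m \<noteq> 0 \<and> (\<forall>r. \<exists>y. zmult m r = \<mu> a y)"
    if "(\<Sum>i\<le>n. zmult (c i) (pw i)) = 0" "\<exists>i\<le>n. c i \<noteq> 0" for n c
    using that
  proof (induction n arbitrary: c)
    case 0
    then show ?case using a by (simp add: pw zmult_eq_0_iff[OF tf])
  next
    case (Suc n)
    define s where "s = (\<Sum>i\<le>n. zmult (c (Suc i)) (pw i))"
    have eq: "zmult (c 0) a + \<mu> a s = 0"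
      using Suc.prems(1) unfolding s_def
      by (simp only: sum.atMost_Suc_shift pw sum_right mult_zmult[OF \<mu>])
    show ?case
    proof (cases "c 0 = 0")
      case True
      then have "s = 0" using eq dom a by auto
      moreover have "\<exists>i\<le>n. c (Suc i) \<noteq> 0"
        using Suc.prems(2) True by (metis Suc_le_mono not0_implies_Suc)
      ultimately show ?thesis using Suc.IH[of "\<lambda>i. c (Suc i)"] unfolding s_def by blast
    next
      case False
      have "\<exists>y. zmult (c 0) r = \<mu> a y" for r
      proof -
        have "\<mu> a (zmult (c 0) r + \<mu> s r) = \<mu> (zmult (c 0) a + \<mu> a s) r"
          by (simp add: mult_add[OF \<mu>] mult_zmult[OF \<mu>] mult_assoc[OF \<mu>])
        then have "zmult (c 0) r + \<mu> s r = 0"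
          using dom a unfolding eq mult_0[OF \<mu>] by blast
        moreover obtain y where "\<mu> s r = \<mu> a y"
          using span_mult[of "\<lambda>i. c (Suc i)" "{..n}" r] unfolding s_def by blast
        ultimately have "zmult (c 0) r = zmult (- 1) (\<mu> a y)"
          by (simp add: zmult_minus_left eq_neg_iff_add_eq_0)
        then show ?thesis unfolding mult_zmult(2)[OF \<mu>, symmetric] by blast
      qed
      then show ?thesis using False by blast
    qed
  qed
  obtain c n where "(\<Sum>i\<le>n. zmult (c i) (pw i)) = 0" "\<exists>i\<le>n. c i \<noteq> 0"
    using finite_rank_relation[OF rank] .
  then show thesis using rel that by blast
qed

text \<open>
  Peel primes off \<open>m = p l\<close>. If \<open>A\<close> lies inside \<open>pG\<close>, then \<open>A = pB\<close> with \<open>lG\<close> inside \<open>B\<close>. Otherwise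
  \<open>A\<close> contains a generator \<open>h\<close> of \<open>G\<close> modulo \<open>pG\<close>, and \<open>lG = l(\<int>h + pG)\<close> is already inside \<open>A\<close>.
\<close>
lemma subgroup_with_bounded_quotient:
  fixes A :: "'a::ab_group_add set"
  assumes cyc: "\<And>p. prime p \<Longrightarrow> cyclic_mod TYPE('a) p"
    and "additive_subgroup_on A" "m > 0" "\<And>x. zmult (int m) x \<in> A"
  obtains d where "A = range (zmult d)"
proof -
  have "\<exists>d. A = range (zmult d)"
    using assms(2-)
  proof (induction m arbitrary: A rule: less_induct)
    case (less m)
    show ?case
    proof (cases "m = 1")
      case True
      then have "A = range (zmult 1)" using less.prems(3) by auto
      then show ?thesis by blast
    next
      case False
      then obtain p where p: "prime p" "p dvd m" using prime_factor_nat by blast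
      then obtain l where m: "m = p * l" by blast
      have l: "l > 0" "l < m" using m less.prems(2) prime_gt_1_nat[OF p(1)] by auto
      show ?thesis
      proof (cases "\<forall>x\<in>A. zdvd (int p) x")
        case True
        let ?B = "{x. zmult (int p) x \<in> A}"
        have "additive_subgroup_on ?B"
          using less.prems(1) by (auto simp: additive_subgroup_on_def zmult_add_right)
        moreover have "zmult (int l) x \<in> ?B" for x
          using less.prems(3) by (simp add: m zmult_zmult)
        ultimately obtain d where d: "?B = range (zmult d)" using less.IH[OF l(2) _ l(1)] by blast
        have "A = zmult (int p) ` ?B" using True unfolding zdvd_def by auto
        also have "\<dots> = range (zmult (int p * d))" unfolding d by (simp add: image_image zmult_zmult)
        finally show ?thesis by blast
      next
        case False
        then obtain h where h: "h \<in> A" "\<not> zdvd (int p) h" by blast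
        have "zmult (int l) x \<in> A" for x
        proof -
          obtain k y where "x - zmult k h = zmult (int p) y"
            using cyc[OF p(1)] h(2) unfolding cyclic_mod_def zdvd_def by blast
          then have "x = zmult (int p) y + zmult k h" by (simp add: diff_eq_eq)
          then have "zmult (int l) x = zmult (int m) y + zmult (int l * k) h"
            by (simp add: m zmult_add_right zmult_zmult mult.commute)
          then show ?thesis
            using less.prems(1,3) subgroup_zmult[OF less.prems(1) h(1)]
            by (simp add: additive_subgroup_on_def)
        qed
        then show ?thesis using less.IH[OF l(2) less.prems(1) l(1)] by blast
      qed
    qed
  qed
  then show thesis using that by blast
qed

text \<open>
  Going down a chain from \<open>G\<close> to \<open>A\<close>, each step preserves the property of containing a principal
  right ideal \<open>bG\<close> with \<open>b \<noteq> 0\<close>: if \<open>bG\<close> lies in one term, then \<open>abG\<close> lies in the next for non-zero \<open>a \<in> A\<close>. So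
  \<open>A\<close> contains some \<open>cG\<close> with \<open>c \<noteq> 0\<close>, and therefore equals some \<open>dG\<close>.
\<close>
lemma filial_if_domain:
  fixes \<mu> :: "'a::ab_group_add \<Rightarrow> 'a \<Rightarrow> 'a"
  assumes rank: "finite_rank TYPE('a)" and \<mu>: "associative_multiplication \<mu>"
    and dom: "\<And>x y. \<mu> x y = 0 \<Longrightarrow> x = 0 \<or> y = 0" and tf: "torsion_free TYPE('a)"
    and cyc: "\<And>p. prime p \<Longrightarrow> cyclic_mod TYPE('a) p"
  shows "filial \<mu>"
  unfolding filial_def
proof (intro allI impI)
  fix A assume "meta_ideal \<mu> A"
  then obtain n C where sub: "additive_subgroup_on A" and C: "C 0 = A" "C n = UNIV"
    "\<And>i. i < n \<Longrightarrow> ideal_of \<mu> (C i) (C (Suc i))"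
    unfolding meta_ideal_def subring_of_def by blast
  show "ideal_of \<mu> A UNIV"
  proof (cases "A = {0}")
    case True
    then show ?thesis using sub by (simp add: ideal_of_def mult_0[OF \<mu>])
  next
    case False
    then obtain a where a: "a \<in> A" "a \<noteq> 0" using sub by (auto simp: additive_subgroup_on_def)
    have aC: "i \<le> n \<Longrightarrow> a \<in> C i" for i
    proof (induction i)
      case (Suc i)
      then show ?case using C(3)[of i] by (auto simp: ideal_of_def)
    qed (simp add: C a)
    have "\<exists>b. b \<noteq> 0 \<and> (\<forall>r. \<mu> b r \<in> C (n - k))" if "k \<le> n" for k
      using that
    proof (induction k)
      case 0
      then show ?case using a C(2) by auto
    next
      case (Suc k)
      then obtain b where b: "b \<noteq> 0" "\<And>r. \<mu> b r \<in> C (n - k)" by auto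
      have "ideal_of \<mu> (C (n - Suc k)) (C (n - k))"
        using C(3)[of "n - Suc k"] Suc.prems by (simp add: Suc_diff_Suc)
      then have "\<mu> (\<mu> a b) r \<in> C (n - Suc k)" for r
        using b(2) aC[of "n - Suc k"] unfolding ideal_of_def mult_assoc[OF \<mu>] by auto
      moreover have "\<mu> a b \<noteq> 0" using dom a b by blast
      ultimately show ?case by blast
    qed
    from this[of n] obtain b where b: "b \<noteq> 0" "\<And>r. \<mu> b r \<in> A" by (auto simp: C)
    obtain c where c: "c \<noteq> 0" "\<And>r. \<exists>y. zmult c r = \<mu> b y"
      using zmult_mem_principal[OF rank \<mu> dom tf b(1)] by blast
    then have cA: "zmult c r \<in> A" for r using b(2) by metis
    have "zmult (int (nat \<bar>c\<bar>)) r \<in> A" for r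
      using cA[of r] cA[of "- r"] by (cases "c \<ge> 0") (simp_all add: zmult_minus_left)
    then obtain d where d: "A = range (zmult d)"
      using subgroup_with_bounded_quotient[OF cyc sub, of "nat \<bar>c\<bar>"] c(1) by auto
    show ?thesis
      using sub unfolding ideal_of_def d by (auto simp: mult_zmult[OF \<mu>])
  qed
qed

section \<open>Heights and types\<close>

lemma p_height_eq_infinity_iff: "p_height p x = \<infinity> \<longleftrightarrow> x \<in> infinite_height p"
proof
  assume inf: "p_height p x = \<infinity>"
  show "x \<in> infinite_height p"
    unfolding infinite_height_def
  proof safe
    fix k
    have "enat k < Sup {enat k | k. \<exists>y. x = zmult (int p ^ k) y}"
      using inf unfolding p_height_def by simp
    then obtain j y where "k < j" "x = zmult (int p ^ j) y" unfolding less_Sup_iff by auto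
    then show "zdvd (int p ^ k) x" by (meson zdvdI zdvd_dvd le_imp_power_dvd less_imp_le)
  qed
next
  assume "x \<in> infinite_height p"
  then have "enat k \<le> p_height p x" for k
    unfolding p_height_def infinite_height_def zdvd_def by (intro Sup_upper) auto
  then show "p_height p x = \<infinity>"
    by (cases "p_height p x") (metis Suc_n_not_le_n enat_ord_simps(1), simp)
qed

lemma equiv_characteristics_sym:
  "equiv_characteristics \<chi> \<psi> \<Longrightarrow> equiv_characteristics \<psi> \<chi>"
  unfolding equiv_characteristics_def by (simp add: eq_commute)

lemma equiv_characteristics_trans:
  assumes "equiv_characteristics \<chi> \<psi>" "equiv_characteristics \<psi> \<phi>"
  shows "equiv_characteristics \<chi> \<phi>"
  unfolding equiv_characteristics_def
proof (intro conjI allI impI)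
  have "{p. \<chi> p \<noteq> \<phi> p} \<subseteq> {p. \<chi> p \<noteq> \<psi> p} \<union> {p. \<psi> p \<noteq> \<phi> p}" by auto
  then show "finite {p. \<chi> p \<noteq> \<phi> p}"
    using assms unfolding equiv_characteristics_def by (meson finite_UnI finite_subset)
qed (use assms in \<open>unfold equiv_characteristics_def, metis\<close>)+

lemma type_of_element_eq_iff:
  "type_of_element g = type_of_element h \<longleftrightarrow>
     equiv_characteristics (characteristic g) (characteristic h)"
proof
  assume "type_of_element g = type_of_element h"
  moreover have "characteristic h \<in> type_of_element h"
    by (simp add: type_of_element_def equiv_characteristics_def)
  ultimately show "equiv_characteristics (characteristic g) (characteristic h)"
    unfolding type_of_element_def by blast
next
  assume "equiv_characteristics (characteristic g) (characteristic h)"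
  then show "type_of_element g = type_of_element h"
    unfolding type_of_element_def
    using equiv_characteristics_sym equiv_characteristics_trans by blast
qed

text \<open>
  An element outside \<open>pG\<close> has \<open>p\<close>-height zero, and equivalent characteristics take the value \<open>\<infinity>\<close> at
  the same primes.
\<close>
lemma homogeneous_imp_finite_heights:
  assumes "homogeneous TYPE('a::ab_group_add)"
  shows "finite_heights TYPE('a)"
  unfolding finite_heights_def
proof (intro allI impI, rule ccontr)
  fix p and g h :: 'a
  assume p: "prime p" and g: "\<not> zdvd (int p) g" and h: "h \<in> infinite_height p" "h \<noteq> 0"
  have "g \<noteq> 0" using g by auto
  then have "equiv_characteristics (characteristic g) (characteristic h)"
    using assms h(2) unfolding homogeneous_def type_of_element_eq_iff by blast
  moreover have "zdvd (int p ^ 1) g" if "g \<in> infinite_height p"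
    using that unfolding infinite_height_def by blast
  then have "g \<notin> infinite_height p" using g by auto
  ultimately show False
    using h(1) p unfolding equiv_characteristics_def characteristic_def p_height_eq_infinity_iff[symmetric]
    by metis
qed

text \<open>
  From \<open>c h = g y\<close> with \<open>c \<noteq> 0\<close>, the \<open>p\<close>-height of \<open>h\<close> is at least that of \<open>g\<close> for all primes \<open>p\<close> that do
  not divide \<open>c\<close>; by symmetry the two heights agree at almost all primes. Finite heights ensure
  that they are infinite at the same primes.
\<close>
lemma homogeneous_if_domain:
  fixes \<mu> :: "'a::ab_group_add \<Rightarrow> 'a \<Rightarrow> 'a"
  assumes rank: "finite_rank TYPE('a)" and \<mu>: "associative_multiplication \<mu>"
    and dom: "\<And>x y. \<mu> x y = 0 \<Longrightarrow> x = 0 \<or> y = 0" and tf: "torsion_free TYPE('a)"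
    and fin: "finite_heights TYPE('a)"
  shows "homogeneous TYPE('a)"
  unfolding homogeneous_def type_of_element_eq_iff
proof (intro allI impI)
  fix g h :: 'a assume "g \<noteq> 0" "h \<noteq> 0"
  have le: "\<exists>c. c \<noteq> 0 \<and> (\<forall>p. prime p \<longrightarrow> \<not> int p dvd c \<longrightarrow> p_height p a \<le> p_height p b)"
    if a: "a \<noteq> 0" for a b :: 'a
  proof -
    obtain c where c: "c \<noteq> 0" "\<And>r. \<exists>y. zmult c r = \<mu> a y"
      using zmult_mem_principal[OF rank \<mu> dom tf a] by blast
    have "p_height p a \<le> p_height p b" if p: "prime p" "\<not> int p dvd c" for p
    proof -
      have "zdvd (int p ^ k) b" if "zdvd (int p ^ k) a" for k
      proof (rule zdvd_coprime_cancel)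
        show "zdvd (int p ^ k) (zmult c b)" using c(2)[of b] mult_zdvd[OF \<mu>] that by metis
        show "coprime (int p ^ k) c" using coprime_int_prime[OF p] by simp
      qed
      then show ?thesis unfolding p_height_def zdvd_def by (intro Sup_subset_mono) blast
    qed
    then show ?thesis using c(1) by blast
  qed
  obtain c where c: "c \<noteq> 0"
    "\<And>p. prime p \<Longrightarrow> \<not> int p dvd c \<Longrightarrow> p_height p g \<le> p_height p h"
    using le[OF \<open>g \<noteq> 0\<close>] by blast
  obtain d where d: "d \<noteq> 0"
    "\<And>p. prime p \<Longrightarrow> \<not> int p dvd d \<Longrightarrow> p_height p h \<le> p_height p g"
    using le[OF \<open>h \<noteq> 0\<close>] by blast
  show "equiv_characteristics (characteristic g) (characteristic h)"
    unfolding equiv_characteristics_def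
  proof (intro conjI allI impI)
    have "{p. characteristic g p \<noteq> characteristic h p} \<subseteq> nat ` {k. k dvd c * d}"
    proof
      fix p assume "p \<in> {p. characteristic g p \<noteq> characteristic h p}"
      then have "prime p" "p_height p g \<noteq> p_height p h"
        by (auto simp: characteristic_def split: if_splits)
      then have "int p dvd c \<or> int p dvd d" using c(2) d(2) by (meson order_antisym)
      then have "int p dvd c * d" by auto
      then show "p \<in> nat ` {k. k dvd c * d}" by (intro image_eqI[of _ _ "int p"]) auto
    qed
    then show "finite {p. characteristic g p \<noteq> characteristic h p}"
      using c(1) d(1) by (rule_tac finite_subset) (auto intro: finite_imageI)
  next
    have inf: "characteristic y p = \<infinity>"
      if x: "x \<noteq> 0" "characteristic x p = \<infinity>" for x y :: 'a and p
    proof -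
      have p: "prime p" "x \<in> infinite_height p"
        using x(2) by (auto simp: characteristic_def p_height_eq_infinity_iff split: if_splits)
      then have div: "zdvd (int p) z" for z :: 'a
        using fin x(1) unfolding finite_heights_def by blast
      have "zdvd (int p ^ k) z" for k and z :: 'a
      proof (induction k arbitrary: z)
        case (Suc k)
        obtain u where u: "z = zmult (int p) u" using div unfolding zdvd_def by blast
        obtain v where "u = zmult (int p ^ k) v" using Suc unfolding zdvd_def by blast
        with u show ?case by (auto simp: zmult_zmult intro: zdvdI)
      qed simp
      then show ?thesis
        using p(1) by (simp add: characteristic_def p_height_eq_infinity_iff infinite_height_def)
    qed
    fix p assume ne: "characteristic g p \<noteq> characteristic h p"
    show "characteristic g p \<noteq> \<infinity>" using ne inf[OF \<open>g \<noteq> 0\<close>] by metis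
    show "characteristic h p \<noteq> \<infinity>" using ne inf[OF \<open>h \<noteq> 0\<close>] by metis
  qed
qed

section \<open>The classification\<close>

theorem theorem11:
  assumes "reduced_group TYPE('a::ab_group_add)"
    and "torsion_free TYPE('a)"
    and "finite_rank TYPE('a)"
  shows "TI_group TYPE('a) \<longleftrightarrow>
    (homogeneous TYPE('a) \<and> Murley_group TYPE('a)) \<or> nil_a_group TYPE('a)"
proof
  assume TI: "TI_group TYPE('a)"
  show "(homogeneous TYPE('a) \<and> Murley_group TYPE('a)) \<or> nil_a_group TYPE('a)"
  proof (cases "nil_a_group TYPE('a)")
    case False
    then obtain \<mu> :: "'a \<Rightarrow> 'a \<Rightarrow> 'a" and a b
      where \<mu>: "associative_multiplication \<mu>" and nz: "\<mu> a b \<noteq> 0"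
      unfolding nil_a_group_def by blast
    note cyc = TI_cyclic_mod[OF TI assms(2,1) \<mu> nz]
    note fin = TI_finite_heights[OF TI assms(2,1) \<mu> nz]
    note dom = no_zero_divisors[OF assms(2,1) cyc fin \<mu> nz]
    have "homogeneous TYPE('a)" by (rule homogeneous_if_domain[OF assms(3) \<mu> dom assms(2) fin])
    moreover have "Murley_group TYPE('a)"
      unfolding Murley_group_def using assms cyc p_rank_le_1_iff by blast
    ultimately show ?thesis by blast
  qed blast
next
  assume R: "(homogeneous TYPE('a) \<and> Murley_group TYPE('a)) \<or> nil_a_group TYPE('a)"
  show "TI_group TYPE('a)"
    unfolding TI_group_def
  proof (intro allI impI)
    fix \<mu> :: "'a \<Rightarrow> 'a \<Rightarrow> 'a" assume \<mu>: "associative_multiplication \<mu>"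
    show "filial \<mu>"
    proof (cases "\<forall>x y. \<mu> x y = 0")
      case True
      then show ?thesis by (intro filial_if_zero) blast
    next
      case False
      then obtain a b where nz: "\<mu> a b \<noteq> 0" by blast
      with R \<mu> have hom: "homogeneous TYPE('a)" and "Murley_group TYPE('a)"
        unfolding nil_a_group_def by blast+
      then have cyc: "cyclic_mod TYPE('a) p" if "prime p" for p
        using that p_rank_le_1_iff unfolding Murley_group_def by blast
      note fin = homogeneous_imp_finite_heights[OF hom]
      note dom = no_zero_divisors[OF assms(2,1) cyc fin \<mu> nz]
      show ?thesis by (rule filial_if_domain[OF assms(3) \<mu> dom assms(2) cyc])
    qed
  qed
qed

end
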